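(* Let $\alpha>0$, let $n$ be the positive integer with $n-1<\alpha\le n$, and let $a<b$ be real numbers with $a\equiv b\pmod 1$. For a function $h$, write $(Qh)(s)=h(a+b-s)$. (1) If $f$ is a real-valued function defined on $\mathbb{N}_a\cap{}_{b}\mathbb{N}$, then for all $t\in\mathbb{N}_{a+1}\cap{}_{b}\mathbb{N}$ $$\nabla_a^{-\alpha}(Qf)(t)=Q\big({}_{b}\nabla^{-\alpha}f\big)(t).$$ (2) If $f$ is a real-valued function defined on $\mathbb{N}_a\cap{}_{b}\mathbb{N}$ and at the points $b+1,\dots,b+n-1$ after $b$, then for all $t\in\mathbb{N}_{a+1}\cap{}_{b}\mathbb{N}$ $${}^{C}\nabla_a^\alpha(Qf)(t)=Q\big({}^{C}_{b}\nabla^\alpha f\big)(t).$$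
   Context: Notation: $\mathbb{N}_a=\{a,a+1,\dots\}$, ${}_{b}\mathbb{N}=\{b,b-1,\dots\}$; $\Delta f(t)=f(t+1)-f(t)$, $\nabla f(t)=f(t)-f(t-1)$, with $\Delta^m,\nabla^m$ their iterates; ${}_{\ominus}\Delta^m f(t)=(-1)^m\Delta^m f(t)$; $\rho(t)=t-1$. Rising function: $t^{\overline{\beta}}=\Gamma(t+\beta)/\Gamma(t)$. For $\nu>0$: the nabla left fractional sum is $\nabla_a^{-\nu}f(t)=\frac{1}{\Gamma(\nu)}\sum_{s=a+1}^{t}(t-\rho(s))^{\overline{\nu-1}}f(s)$, $t\in\mathbb{N}_{a+1}$, and the nabla right fractional sum is ${}_{b}\nabla^{-\nu}f(t)=\frac{1}{\Gamma(\nu)}\sum_{s=t}^{b-1}(s-\rho(t))^{\overline{\nu-1}}f(s)$, $t\in{}_{b-1}\mathbb{N}$. With $n-1<\alpha\le n$, the nabla Caputo fractional differences are, for $\alpha<n$, ${}^{C}\nabla_a^\alpha f(t)=\nabla_a^{-(n-\alpha)}(\nabla^n f)(t)$ and ${}_{b}^{C}\nabla^\alpha f(t)={}_{b}\nabla^{-(n-\alpha)}({}_{\ominus}\Delta^n f)(t)$; for $\alpha=n$ they are $\nabla^n f(t)$ and ${}_{\ominus}\Delta^n f(t)$. *)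

theory Defs
  imports "HOL-Analysis.Gamma_Function" "HOL-Library.Real_Mod"
begin

definition nats_from :: "real \<Rightarrow> real set" where
  "nats_from a = {a + real k |k. True}"

definition nats_downto :: "real \<Rightarrow> real set" where
  "nats_downto b = {b - real k |k. True}"

definition forward_diff :: "(real \<Rightarrow> real) \<Rightarrow> real \<Rightarrow> real" where
  "forward_diff f t = f (t + 1) - f t"

definition backward_diff :: "(real \<Rightarrow> real) \<Rightarrow> real \<Rightarrow> real" where
  "backward_diff f t = f t - f (t - 1)"

definition ominus_forward_diff :: "nat \<Rightarrow> (real \<Rightarrow> real) \<Rightarrow> real \<Rightarrow> real" where
  "ominus_forward_diff m f t = (-1) ^ m * (forward_diff ^^ m) f t"

definition back_jump :: "real \<Rightarrow> real" where
  "back_jump t = t - 1"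

text \<open>The real exponent makes this different from \<^const>\<open>pochhammer\<close>. Below it is only
  evaluated where both arguments of the Gamma function are positive.\<close>

definition rising :: "real \<Rightarrow> real \<Rightarrow> real" where
  "rising t \<beta> = Gamma (t + \<beta>) / Gamma t"

text \<open>The summation range \<open>s = c, \<dots>, d\<close> with step 1 between reals is
  \<^term>\<open>nats_from c \<inter> nats_downto d\<close>. For \<open>d - c\<close> an integer it is finite, and empty
  if \<open>d < c\<close>.\<close>

definition nabla_left_sum :: "real \<Rightarrow> real \<Rightarrow> (real \<Rightarrow> real) \<Rightarrow> real \<Rightarrow> real" where
  "nabla_left_sum a \<nu> f t =
     1 / Gamma \<nu> *
       (\<Sum>s \<in> nats_from (a + 1) \<inter> nats_downto t. rising (t - back_jump s) (\<nu> - 1) * f s)"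

definition nabla_right_sum :: "real \<Rightarrow> real \<Rightarrow> (real \<Rightarrow> real) \<Rightarrow> real \<Rightarrow> real" where
  "nabla_right_sum b \<nu> f t =
     1 / Gamma \<nu> *
       (\<Sum>s \<in> nats_from t \<inter> nats_downto (b - 1). rising (s - back_jump t) (\<nu> - 1) * f s)"

text \<open>The order \<open>n\<close> is a parameter of the Caputo differences. They are meant for
  \<open>n - 1 < \<alpha> \<le> n\<close>, so the last case is \<open>\<alpha> = n\<close>.\<close>

definition nabla_left_caputo ::
    "nat \<Rightarrow> real \<Rightarrow> real \<Rightarrow> (real \<Rightarrow> real) \<Rightarrow> real \<Rightarrow> real" where
  "nabla_left_caputo n a \<alpha> f t =
     (if \<alpha> < real n then nabla_left_sum a (real n - \<alpha>) ((backward_diff ^^ n) f) t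
      else (backward_diff ^^ n) f t)"

definition nabla_right_caputo ::
    "nat \<Rightarrow> real \<Rightarrow> real \<Rightarrow> (real \<Rightarrow> real) \<Rightarrow> real \<Rightarrow> real" where
  "nabla_right_caputo n b \<alpha> f t =
     (if \<alpha> < real n then nabla_right_sum b (real n - \<alpha>) (ominus_forward_diff n f) t
      else ominus_forward_diff n f t)"

definition reflect :: "real \<Rightarrow> real \<Rightarrow> (real \<Rightarrow> real) \<Rightarrow> real \<Rightarrow> real" where
  "reflect a b h s = h (a + b - s)"

text \<open>Functions on a discrete domain are represented by arbitrary total extensions. The following
  facts show that this is harmless: for the arguments of interest, the operators only look at
  values on the stated domain, that is \<open>{a, \<dots>, b}\<close> for the fractional sums, and
  \<open>{a, \<dots>, b + n - 1}\<close> for the Caputo differences of order at most \<open>n\<close>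
  (reflected: \<open>{a - n + 1, \<dots>, b}\<close>).\<close>

lemma nabla_left_sum_cong:
  assumes "t \<in> nats_downto b"
    and "\<And>s. s \<in> nats_from a \<inter> nats_downto b \<Longrightarrow> f s = g s"
  shows "nabla_left_sum a \<nu> f t = nabla_left_sum a \<nu> g t"
proof -
  have "f s = g s" if s: "s \<in> nats_from (a + 1) \<inter> nats_downto t" for s
  proof -
    obtain l where "t = b - real l"
      using assms(1) unfolding nats_downto_def by blast
    moreover obtain j k where "s = a + 1 + real j" "s = t - real k"
      using s unfolding nats_from_def nats_downto_def by blast
    ultimately have "s = a + real (Suc j)" "s = b - real (k + l)"
      by simp_all
    then show ?thesis
      by (intro assms(2)) (unfold nats_from_def nats_downto_def, blast)
  qed
  then show ?thesis
    by (simp add: nabla_left_sum_def)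
qed

lemma nabla_right_sum_cong:
  assumes "t \<in> nats_from a"
    and "\<And>s. s \<in> nats_from a \<inter> nats_downto b \<Longrightarrow> f s = g s"
  shows "nabla_right_sum b \<nu> f t = nabla_right_sum b \<nu> g t"
proof -
  have "f s = g s" if s: "s \<in> nats_from t \<inter> nats_downto (b - 1)" for s
  proof -
    obtain l where "t = a + real l"
      using assms(1) unfolding nats_from_def by blast
    moreover obtain j k where "s = t + real j" "s = b - 1 - real k"
      using s unfolding nats_from_def nats_downto_def by blast
    ultimately have "s = a + real (l + j)" "s = b - real (Suc k)"
      by simp_all
    then show ?thesis
      by (intro assms(2)) (unfold nats_from_def nats_downto_def, blast)
  qed
  then show ?thesis
    by (simp add: nabla_right_sum_def)
qed

lemma backward_diff_iter_cong:
  assumes "\<And>k. k \<le> n \<Longrightarrow> f (t - real k) = g (t - real k)"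
  shows "(backward_diff ^^ n) f t = (backward_diff ^^ n) g t"
  using assms
proof (induction n arbitrary: t)
  case (Suc n)
  have "(backward_diff ^^ n) f t = (backward_diff ^^ n) g t"
    using Suc.prems by (intro Suc.IH) simp
  moreover have "(backward_diff ^^ n) f (t - 1) = (backward_diff ^^ n) g (t - 1)"
  proof (rule Suc.IH)
    show "f (t - 1 - real k) = g (t - 1 - real k)" if "k \<le> n" for k
      using Suc.prems[of "Suc k"] that by (simp add: algebra_simps)
  qed
  ultimately show ?case
    by (simp add: backward_diff_def [of "(backward_diff ^^ n) _"])
qed simp

lemma forward_diff_iter_cong:
  assumes "\<And>k. k \<le> n \<Longrightarrow> f (t + real k) = g (t + real k)"
  shows "(forward_diff ^^ n) f t = (forward_diff ^^ n) g t"
  using assms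
proof (induction n arbitrary: t)
  case (Suc n)
  have "(forward_diff ^^ n) f t = (forward_diff ^^ n) g t"
    using Suc.prems by (intro Suc.IH) simp
  moreover have "(forward_diff ^^ n) f (t + 1) = (forward_diff ^^ n) g (t + 1)"
  proof (rule Suc.IH)
    show "f (t + 1 + real k) = g (t + 1 + real k)" if "k \<le> n" for k
      using Suc.prems[of "Suc k"] that by (simp add: algebra_simps)
  qed
  ultimately show ?case
    by (simp add: forward_diff_def [of "(forward_diff ^^ n) _"])
qed simp

lemma nabla_left_caputo_cong:
  assumes "t \<in> nats_from (a + 1) \<inter> nats_downto b" "0 < n"
    and fg: "\<And>s. s \<in> nats_from (a - (real n - 1)) \<inter> nats_downto b \<Longrightarrow> f s = g s"
  shows "nabla_left_caputo n a \<alpha> f t = nabla_left_caputo n a \<alpha> g t"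
proof -
  have *: "(backward_diff ^^ n) f s = (backward_diff ^^ n) g s"
    if s: "s \<in> nats_from (a + 1) \<inter> nats_downto b" for s
  proof (rule backward_diff_iter_cong)
    fix k assume k: "k \<le> n"
    obtain i j where "s = a + 1 + real i" "s = b - real j"
      using s unfolding nats_from_def nats_downto_def by blast
    then have "s - real k = a - (real n - 1) + real (i + (n - k))" "s - real k = b - real (j + k)"
      using k by (simp_all add: of_nat_diff)
    then show "f (s - real k) = g (s - real k)"
      by (intro fg) (unfold nats_from_def nats_downto_def, blast)
  qed
  have "s \<in> nats_downto b" if "s \<in> nats_downto t" for s
  proof -
    from that assms(1) obtain k l where "s = t - real k" "t = b - real l"
      by (auto simp: nats_downto_def)
    then have "s = b - real (l + k)" by simp
    then show ?thesis unfolding nats_downto_def by blast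
  qed
  with * have "nabla_left_sum a \<nu> ((backward_diff ^^ n) f) t
      = nabla_left_sum a \<nu> ((backward_diff ^^ n) g) t" for \<nu>
    by (simp add: nabla_left_sum_def)
  with * assms(1) show ?thesis
    by (simp add: nabla_left_caputo_def)
qed

lemma nabla_right_caputo_cong:
  assumes "t \<in> nats_from a \<inter> nats_downto (b - 1)" "0 < n"
    and fg: "\<And>s. s \<in> nats_from a \<inter> nats_downto (b + (real n - 1)) \<Longrightarrow> f s = g s"
  shows "nabla_right_caputo n b \<alpha> f t = nabla_right_caputo n b \<alpha> g t"
proof -
  have *: "ominus_forward_diff n f s = ominus_forward_diff n g s"
    if s: "s \<in> nats_from a \<inter> nats_downto (b - 1)" for s
  proof -
    have "(forward_diff ^^ n) f s = (forward_diff ^^ n) g s"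
    proof (rule forward_diff_iter_cong)
      fix k assume k: "k \<le> n"
      obtain i j where "s = a + real i" "s = b - 1 - real j"
        using s unfolding nats_from_def nats_downto_def by blast
      then have "s + real k = a + real (i + k)"
          "s + real k = b + (real n - 1) - real (j + (n - k))"
        using k by (simp_all add: of_nat_diff)
      then show "f (s + real k) = g (s + real k)"
        by (intro fg) (unfold nats_from_def nats_downto_def, blast)
    qed
    then show ?thesis by (simp add: ominus_forward_diff_def)
  qed
  have "s \<in> nats_from a" if "s \<in> nats_from t" for s
  proof -
    from that assms(1) obtain k l where "s = t + real k" "t = a + real l"
      by (auto simp: nats_from_def)
    then have "s = a + real (l + k)" by simp
    then show ?thesis unfolding nats_from_def by blast
  qed
  with * have "nabla_right_sum b \<nu> (ominus_forward_diff n f) t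
      = nabla_right_sum b \<nu> (ominus_forward_diff n g) t" for \<nu>
    by (simp add: nabla_right_sum_def)
  with * assms(1) show ?thesis
    by (simp add: nabla_right_caputo_def)
qed

end

theory Submission
  imports Defs
begin

text \<open>The reflection \<open>s \<mapsto> a + b - s\<close> exchanges the left and the right calculus.
  It maps the summation range \<open>a + 1, \<dots>, t\<close> of the left sum bijectively onto the range
  \<open>a + b - t, \<dots>, b - 1\<close> of the right sum at the reflected point, and it preserves the kernel,
  which depends only on the distance between \<open>s\<close> and \<open>t\<close>; this is
  \<open>nabla_left_sum_reflect\<close>. It also reverses the direction of a step, so that it turns
  \<open>\<nabla>\<close> into \<open>-\<Delta>\<close>; iterating this produces exactly the sign \<open>(-1)\<^sup>n\<close> in
  \<open>ominus_forward_diff\<close> (\<open>backward_diff_iter_reflect\<close>). The Caputo differences are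
  compositions of the two operations, hence are exchanged as well.\<close>

lemma nats_from_reflect_iff: "c - s \<in> nats_from d \<longleftrightarrow> s \<in> nats_downto (c - d)"
  unfolding nats_from_def nats_downto_def mem_Collect_eq simp_thms
  by (rule ex_cong1) linarith

lemma nats_downto_reflect_iff: "c - s \<in> nats_downto d \<longleftrightarrow> s \<in> nats_from (c - d)"
  unfolding nats_from_def nats_downto_def mem_Collect_eq simp_thms
  by (rule ex_cong1) linarith

lemma nabla_left_sum_reflect:
  "nabla_left_sum a \<nu> (reflect a b f) = reflect a b (nabla_right_sum b \<nu> f)"
proof
  fix t
  have "(\<Sum>s \<in> nats_from (a + 1) \<inter> nats_downto t.
            rising (t - back_jump s) (\<nu> - 1) * f (a + b - s))
      = (\<Sum>s \<in> nats_from (a + b - t) \<inter> nats_downto (b - 1).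
            rising (s - back_jump (a + b - t)) (\<nu> - 1) * f s)"
    by (rule sum.reindex_bij_witness[where i = "\<lambda>s. a + b - s" and j = "\<lambda>s. a + b - s"])
      (auto simp: nats_from_reflect_iff nats_downto_reflect_iff back_jump_def algebra_simps)
  then show "nabla_left_sum a \<nu> (reflect a b f) t = reflect a b (nabla_right_sum b \<nu> f) t"
    by (simp add: nabla_left_sum_def nabla_right_sum_def reflect_def)
qed

lemma backward_diff_iter_reflect:
  "(backward_diff ^^ n) (reflect a b f) = reflect a b (ominus_forward_diff n f)"
proof (induction n)
  case 0
  show ?case
    by (simp add: ominus_forward_diff_def reflect_def fun_eq_iff)
next
  case (Suc n)
  have "backward_diff (reflect a b (ominus_forward_diff n f)) t
      = reflect a b (ominus_forward_diff (Suc n) f) t" for t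
  proof -
    have step: "a + b - (t - 1) = a + b - t + 1"
      by simp
    show ?thesis
      unfolding backward_diff_def reflect_def ominus_forward_diff_def step
      by (simp add: forward_diff_def [of "(forward_diff ^^ n) f"] algebra_simps)
  qed
  then show ?case
    by (simp add: Suc.IH fun_eq_iff)
qed

lemma nabla_left_caputo_reflect:
  "nabla_left_caputo n a \<alpha> (reflect a b f) = reflect a b (nabla_right_caputo n b \<alpha> f)"
proof
  fix t
  show "nabla_left_caputo n a \<alpha> (reflect a b f) t = reflect a b (nabla_right_caputo n b \<alpha> f) t"
    unfolding nabla_left_caputo_def backward_diff_iter_reflect nabla_left_sum_reflect
    by (simp add: nabla_right_caputo_def reflect_def)
qed

theorem mainTheorem11:
  fixes \<alpha> a b :: real and n :: nat
  assumes "\<alpha> > 0"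
    and "n > 0" and "real n - 1 < \<alpha>" and "\<alpha> \<le> real n"
    and "a < b" and "[a = b] (rmod 1)"
  shows "(\<forall>f :: real \<Rightarrow> real. \<forall>t \<in> nats_from (a + 1) \<inter> nats_downto b.
            nabla_left_sum a \<alpha> (reflect a b f) t = reflect a b (nabla_right_sum b \<alpha> f) t)
       \<and> (\<forall>f :: real \<Rightarrow> real. \<forall>t \<in> nats_from (a + 1) \<inter> nats_downto b.
            nabla_left_caputo n a \<alpha> (reflect a b f) t
              = reflect a b (nabla_right_caputo n b \<alpha> f) t)"
  by (simp add: nabla_left_sum_reflect nabla_left_caputo_reflect)

end
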